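(* Let $(h_n)_{n\ge 0}$ and $(j_r)_{r\ge 1}$ be sequences of complex numbers with $h_0=1$ satisfying \[ n\,h_n=\sum_{r=1}^{n} j_r\,h_{n-r}\qquad\text{for all } n\ge 1 . \] For $n\ge 1$ let $J_n$ be the $n\times n$ matrix \[ J_n=\begin{pmatrix} j_1 & -1 & 0 & \cdots & 0 \\ j_2 & j_1 & -2 & \cdots & 0 \\ \vdots & \vdots & \vdots & \ddots & \vdots \\ j_{n-1} & j_{n-2} & \cdots & j_1 & -(n-1)\\ j_n & j_{n-1} & \cdots & j_2 & j_1 \end{pmatrix}, \] i.e. the $(i,k)$ entry is $j_{i-k+1}$ if $k\le i$, is $-i$ if $k=i+1$, and is $0$ if $k>i+1$. Then the characteristic polynomial $\chi(J_n)(x)=\det(xI_n-J_n)$ satisfies \[ \chi(J_n)(x)=\sum_{r=0}^{n}\binom{n}{r}\, r!\, h_r\,(-1)^r\,x^{\,n-r}. \]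
   Context: $I_n$ denotes the $n\times n$ identity matrix and $\chi(M)(x)=\det(xI_n-M)$ denotes the characteristic polynomial of an $n\times n$ matrix $M$. The convention $0!\,h_0=1$ is used for the $r=0$ term. *)

theory Defs
  imports Complex_Main "Jordan_Normal_Form.Char_Poly"
begin

text \<open>Matrix indices start at 0, so the 1-based entry (i, k) is found at (i - 1, k - 1).
  In particular the superdiagonal entry of the 0-based row i is - (i + 1).
  The value of j at 0 is not used.\<close>

definition J_mat :: "(nat \<Rightarrow> complex) \<Rightarrow> nat \<Rightarrow> complex mat" where
  "J_mat j n = mat n n (\<lambda>(i, k).
     if k \<le> i then j (i - k + 1)
     else if k = i + 1 then - of_nat (i + 1)
     else 0)"

end

theory Submission
  imports Defs "HOL-Computational_Algebra.Formal_Power_Series"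
begin

text \<open>Let \<open>V = H(t) e\<^sup>-\<^sup>x\<^sup>t\<close>, where \<open>H\<close> is the generating function of \<open>h\<close>. The recurrence for \<open>h\<close>
  says \<open>H' = D H\<close> with \<open>D = (\<Sum>r. j\<^sub>r\<^sub>+\<^sub>1 t\<^sup>r)\<close>, so \<open>V' = D V - x V\<close>. Comparing coefficients,
  the column of coefficients of \<open>V\<close> is annihilated by every row of \<open>x I - J\<^sub>n\<close> except the last,
  which gives \<open>- n V\<^sub>n\<close>. As that matrix is lower Hessenberg and \<open>V\<^sub>0 = 1\<close>, its determinant can be
  read off from this value and the superdiagonal.\<close>

text \<open>By Cramer, replacing column 0 by \<open>A v\<close> multiplies the determinant by
  \<open>v 0 = 1\<close>. The new column vanishes outside the last row, so Laplace expansion along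
  it leaves a single minor.\<close>

lemma det_lower_hessenberg:
  fixes A :: "'a :: comm_ring_1 mat"
  assumes A: "A \<in> carrier_mat (Suc n) (Suc n)"
    and hess: "\<And>i k. Suc i < k \<Longrightarrow> k \<le> n \<Longrightarrow> A $$ (i, k) = 0"
    and v0: "v 0 = 1"
    and ker: "\<And>i. i < n \<Longrightarrow> (\<Sum>k\<le>n. A $$ (i, k) * v k) = 0"
  shows "det A = (\<Sum>k\<le>n. A $$ (n, k) * v k) * (-1) ^ n * (\<Prod>i<n. A $$ (i, Suc i))"
proof -
  define x where "x = vec (Suc n) v"
  define B where "B = replace_col A (A *\<^sub>v x) 0"
  have B: "B \<in> carrier_mat (Suc n) (Suc n)"
    using A by (auto simp: B_def replace_col_def)
  have Ax: "(A *\<^sub>v x) $ i = (\<Sum>k\<le>n. A $$ (i, k) * v k)" if "i \<le> n" for i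
    using A that
    by (auto simp: x_def scalar_prod_def lessThan_Suc_atMost atLeast0LessThan intro!: sum.cong)
  have B0: "B $$ (i, 0) = (if i < n then 0 else \<Sum>k\<le>n. A $$ (n, k) * v k)" if "i \<le> n" for i
    using that A Ax[of i] ker[of i] by (auto simp: B_def replace_col_def)
  \<comment> \<open>Dropping column 0 shifts columns by one: the superdiagonal of \<open>A\<close>
    becomes the diagonal of the minor, and the Hessenberg zeros become the zeros above it.\<close>
  have minor: "mat_delete B n 0 $$ (i, k) = A $$ (i, Suc k)" if "i < n" "k < n" for i k
    using that A by (auto simp: mat_delete_def B_def replace_col_def)
  have minor_carrier: "mat_delete B n 0 \<in> carrier_mat n n"
    using mat_delete_carrier[OF B, of n 0] by simp
  have "det (mat_delete B n 0) = prod_list (diag_mat (mat_delete B n 0))"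
    by (rule det_lower_triangular[OF _ minor_carrier]) (auto simp: minor hess)
  also have "\<dots> = (\<Prod>i<n. A $$ (i, Suc i))"
    using minor_carrier
    by (auto simp: prod_list_diag_prod atLeast0LessThan minor intro!: prod.cong)
  finally have det_minor: "det (mat_delete B n 0) = (\<Prod>i<n. A $$ (i, Suc i))" .
  have "det B = x $ 0 * det A"
    unfolding B_def by (rule cramer_lemma_mat[OF A]) (auto simp: x_def)
  then have "det A = det B"
    by (simp add: x_def v0)
  also have "\<dots> = (\<Sum>i<Suc n. B $$ (i, 0) * cofactor B i 0)"
    by (rule laplace_expansion_column[OF B]) simp
  also have "\<dots> = B $$ (n, 0) * cofactor B n 0"
    by (simp add: B0)
  finally show ?thesis
    by (simp add: B0 cofactor_def det_minor mult.assoc)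
qed

text \<open>\<open>V k\<close> is the coefficient of \<open>t^k\<close> in
  \<open>H(t) e^(-xt)\<close>, and the claim compares coefficients of \<open>t^i\<close> in the
  differential equation of this product.\<close>

lemma newton_twist_recurrence:
  fixes h j :: "nat \<Rightarrow> complex" and i :: nat
  defines "V \<equiv> \<lambda>k. \<Sum>r\<le>k. monom (h r * (-1) ^ (k - r) / fact (k - r)) (k - r)"
  assumes rec: "\<And>m. m \<ge> 1 \<Longrightarrow> of_nat m * h m = (\<Sum>r=1..m. j r * h (m - r))"
  shows "of_nat (Suc i) * V (Suc i) = (\<Sum>k\<le>i. [:j (i - k + 1):] * V k) - [:0, 1:] * V i"
proof -
  define H :: "complex poly fps" where "H = Abs_fps (\<lambda>k. [:h k:])"
  define D :: "complex poly fps" where "D = Abs_fps (\<lambda>k. [:j (Suc k):])"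
  \<comment> \<open>This is \<open>e^(-xt)\<close>, with \<open>x\<close> the polynomial variable
    and \<open>t\<close> the series variable. Polynomials in \<open>x\<close> do not form a field,
    so the factorials are divided out in the complex coefficients.\<close>
  define E :: "complex poly fps" where "E = Abs_fps (\<lambda>k. monom ((-1) ^ k / fact k) k)"
  have HE: "fps_nth (H * E) k = V k" for k
    by (auto simp: fps_mult_nth H_def E_def V_def atLeast0AtMost smult_monom intro!: sum.cong)
  have "fps_deriv H = D * H"
  proof (rule fps_ext)
    fix k
    have "of_nat (Suc k) * h (Suc k) = (\<Sum>r=1..Suc k. j r * h (Suc k - r))"
      by (rule rec) simp
    also have "\<dots> = (\<Sum>r=0..k. j (Suc r) * h (k - r))"
      using sum.shift_bounds_cl_Suc_ivl[of "\<lambda>r. j r * h (Suc k - r)" 0 k] by simp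
    finally have "[:of_nat (Suc k) * h (Suc k):] = [:\<Sum>r=0..k. j (Suc r) * h (k - r):]"
      by simp
    moreover have "[:\<Sum>r\<in>S. f r:] = (\<Sum>r\<in>S. [:f r:])" for S and f :: "nat \<Rightarrow> complex"
      by (auto simp: poly_eq_iff coeff_sum coeff_pCons split: nat.splits)
    ultimately show "fps_nth (fps_deriv H) k = fps_nth (D * H) k"
      by (simp add: fps_mult_nth H_def D_def of_nat_poly mult.commute[where 'a = complex]
          del: of_nat_Suc)
  qed
  moreover have "fps_deriv E = - (fps_const [:0, 1:] * E)"
  proof (rule fps_ext)
    fix k
    have "of_nat (Suc k) * ((-1) ^ Suc k / fact (Suc k) :: complex) = - ((-1) ^ k / fact k)"
      by (simp add: field_simps del: of_nat_Suc)
    then show "fps_nth (fps_deriv E) k = fps_nth (- (fps_const [:0, 1:] * E)) k"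
      by (simp add: E_def of_nat_poly smult_monom monom_Suc[symmetric] minus_monom
          del: of_nat_Suc power_Suc)
  qed
  ultimately have "fps_deriv (H * E) = D * (H * E) - fps_const [:0, 1:] * (H * E)"
    by (simp add: algebra_simps)
  \<comment> \<open>With \<open>D\<close> as the right factor, the convolution index falls on
    \<open>V\<close>, as in a row of the matrix.\<close>
  then have "fps_nth (fps_deriv (H * E)) i
      = fps_nth ((H * E) * D) i - fps_nth (fps_const [:0, 1:] * (H * E)) i"
    by (simp add: mult.commute)
  then have "of_nat (Suc i) * V (Suc i)
      = (\<Sum>k=0..i. V k * fps_nth D (i - k)) - [:0, 1:] * V i"
    unfolding fps_mult_nth[of "H * E" D] fps_deriv_nth fps_mult_left_const_nth HE by simp
  then show ?thesis
    by (simp add: D_def atLeast0AtMost mult.commute)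
qed

theorem theorem2p3:
  fixes h j :: "nat \<Rightarrow> complex" and n :: nat
  assumes "h 0 = 1"
    and "\<And>m. m \<ge> 1 \<Longrightarrow> of_nat m * h m = (\<Sum>r=1..m. j r * h (m - r))"
    and "n \<ge> 1"
  shows "char_poly (J_mat j n) =
    (\<Sum>r=0..n. monom (of_nat (n choose r) * fact r * h r * (-1) ^ r) (n - r))"
proof -
  define V where "V = (\<lambda>k. \<Sum>r\<le>k. monom (h r * (-1) ^ (k - r) / fact (k - r)) (k - r))"
  define A where "A = char_poly_matrix (J_mat j n)"
  obtain m where n: "n = Suc m"
    using \<open>n \<ge> 1\<close> by (cases n) auto
  have A: "A \<in> carrier_mat (Suc m) (Suc m)"
    by (simp add: A_def n J_mat_def)
  have entry: "A $$ (i, k) = (if k = i then [:0, 1:] else 0) +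
      (if k \<le> i then [:- j (i - k + 1):] else if k = Suc i then of_nat (Suc i) else 0)"
    if "i \<le> m" "k \<le> m" for i k
    using that by (auto simp: A_def char_poly_matrix_def J_mat_def n of_nat_poly)
  have rec: "of_nat (Suc i) * V (Suc i) = (\<Sum>k\<le>i. [:j (i - k + 1):] * V k) - [:0, 1:] * V i" for i
    unfolding V_def by (rule newton_twist_recurrence[OF assms(2)])
  \<comment> \<open>The row is summed only up to the diagonal. For \<open>i < m\<close> the
    superdiagonal term \<open>(i + 1) V (i + 1)\<close> cancels this value; row \<open>m\<close> has
    no such entry, so \<open>- n V n\<close> remains.\<close>
  have lower: "(\<Sum>k\<le>i. A $$ (i, k) * V k) = - (of_nat (Suc i) * V (Suc i))" if "i \<le> m" for i
  proof -
    have "(\<Sum>k\<le>i. A $$ (i, k) * V k)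
        = (\<Sum>k\<le>i. (if k = i then [:0, 1:] * V k else 0) - [:j (i - k + 1):] * V k)"
      using that by (intro sum.cong) (auto simp: entry algebra_simps)
    also have "\<dots> = [:0, 1:] * V i - (\<Sum>k\<le>i. [:j (i - k + 1):] * V k)"
      by (simp add: sum_subtractf)
    finally show ?thesis
      by (simp only: rec minus_diff_eq)
  qed
  have "det A = (\<Sum>k\<le>m. A $$ (m, k) * V k) * (-1) ^ m * (\<Prod>i<m. A $$ (i, Suc i))"
  proof (rule det_lower_hessenberg[OF A])
    show "A $$ (i, k) = 0" if "Suc i < k" "k \<le> m" for i k
      using that by (simp add: entry)
    show "V 0 = 1"
      by (simp add: V_def assms(1))
    show "(\<Sum>k\<le>m. A $$ (i, k) * V k) = 0" if "i < m" for i
    proof -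
      have "(\<Sum>k\<le>m. A $$ (i, k) * V k) = (\<Sum>k\<le>Suc i. A $$ (i, k) * V k)"
        using that by (intro sum.mono_neutral_right) (auto simp: entry)
      then show ?thesis
        using that lower[of i] entry[of i "Suc i"] by (simp del: of_nat_Suc)
    qed
  qed
  also have "(\<Prod>i<m. A $$ (i, Suc i)) = (\<Prod>i<m. of_nat (Suc i))"
    by (intro prod.cong) (auto simp: entry)
  also have "\<dots> = fact m"
    by (simp add: fact_prod_Suc atLeast0LessThan)
  \<comment> \<open>The factor \<open>- n\<close> from the last row turns \<open>(-1)^m m!\<close>
    into \<open>(-1)^n n!\<close>.\<close>
  also have "(\<Sum>k\<le>m. A $$ (m, k) * V k) * (-1) ^ m * fact m = (-1) ^ n * fact n * V n"
    unfolding lower[OF order_refl] n by (simp add: algebra_simps)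
  also have "\<dots> = Polynomial.smult ((-1) ^ n * fact n) (V n)"
  proof -
    \<comment> \<open>The factor is the image of an integer, hence a constant polynomial. As a
      complex scalar it can be combined with \<open>1 / (n - r)!\<close> in each
      coefficient.\<close>
    have "(-1) ^ n * fact n = [:(-1) ^ n * fact n :: complex:]"
      by (metis (no_types) of_int_fact of_int_minus of_int_mult of_int_power of_int_1 of_int_poly)
    then show ?thesis by simp
  qed
  also have "\<dots> = (\<Sum>r\<le>n. monom ((-1) ^ n * fact n * (h r * (-1) ^ (n - r) / fact (n - r))) (n - r))"
    by (simp add: V_def smult_sum2 smult_monom)
  also have "\<dots> = (\<Sum>r=0..n. monom (of_nat (n choose r) * fact r * h r * (-1) ^ r) (n - r))"
  proof (intro sum.cong)
    fix r assume "r \<in> {0..n}"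
    then have r: "r \<le> n" by simp
    \<comment> \<open>The total exponent \<open>2 n - r\<close> has the parity of
      \<open>r\<close>.\<close>
    have "(-1) ^ n * (-1) ^ (n - r) = ((-1) ^ r :: complex)"
      using r by (simp add: power_add[symmetric] minus_one_power_iff)
    moreover have "fact n / fact (n - r) = (of_nat (n choose r) * fact r :: complex)"
      using r by (simp add: binomial_fact)
    ultimately have "(-1) ^ n * fact n * (h r * (-1) ^ (n - r) / fact (n - r))
        = of_nat (n choose r) * fact r * h r * (-1) ^ r"
      by (metis (no_types, opaque_lifting) mult.assoc mult.commute times_divide_eq_right)
    then show "monom ((-1) ^ n * fact n * (h r * (-1) ^ (n - r) / fact (n - r))) (n - r)
        = monom (of_nat (n choose r) * fact r * h r * (-1) ^ r) (n - r)"
      by simp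
  qed auto
  finally show ?thesis
    by (simp add: char_poly_def A_def)
qed

end
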